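(* Suppose that $\kappa$ is an uncountable cardinal which is nearly $\lambda$-strongly compact for unboundedly many cardinals $\lambda$. Then $\kappa$ is strongly compact.
   Context: For cardinals $\kappa\le\lambda$, $\mathscr{P}_\kappa(\lambda)=\{a\subseteq\lambda: |a|<\kappa\}$. A filter $\mathscr{F}$ on a set $X$ is $(<\kappa)$-complete if the intersection of any subfamily of $\mathscr{F}$ of size $<\kappa$ is in $\mathscr{F}$; it is non-principal if it is not of the form $\{A\subseteq X: Y\subseteq A\}$ for a nonempty $Y\subseteq X$. A family $\mathscr{A}'\subseteq\mathscr{P}(X)$ measures $A\subseteq X$ if $A\in\mathscr{A}'$ or $X\setminus A\in\mathscr{A}'$, and measures a family if it measures each member. A filter $\mathscr{F}$ on $\mathscr{P}_\kappa(\lambda)$ is fine if $\{a\in\mathscr{P}_\kappa(\lambda):\alpha\in a\}\in\mathscr{F}$ for every $\alpha<\lambda$. $\kappa$ is nearly $\lambda$-strongly compact if for every family $\mathscr{A}$ of $\lambda$-many subsets of $\mathscr{P}_\kappa(\lambda)$ there is a non-principal $(<\kappa)$-complete fine filter over $\mathscr{P}_\kappa(\lambda)$ measuring $\mathscr{A}$. $\kappa$ is strongly compact if for every $\lambda\ge\kappa$, every $(<\kappa)$-complete filter over any set generated by at most $\lambda$ elements extends to a $(<\kappa)$-complete ultrafilter over that set. *)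

theory Defs
  imports "HOL-Library.Countable_Set"
begin

unbundle cardinal_syntax

text \<open>
  The ambient set theory: a type whose elements are the sets of a ZFC universe, where \<open>elts x\<close> is
  the collection of members of \<open>x\<close>. The schemes of separation and replacement, and foundation, are
  stated for arbitrary HOL predicates, functions and classes. No axiom of choice is listed:
  separation, union and powerset together with the choice operator of HOL yield a choice function
  in the universe for every family of nonempty sets.

  A HOL set of elements of the universe is a set of the universe precisely if it is of the form
  \<open>elts x\<close>. By separation and powerset, every subset of \<open>elts x\<close>, every family of subsets of
  \<open>elts x\<close> and every function between such sets is coded by a set of the universe. Therefore
  families of subsets of \<open>elts x\<close> are represented as HOL sets of sets, and cardinalities of sets
  are compared by the HOL relations \<open><o\<close>, \<open>\<le>o\<close> and \<open>=o\<close>.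
\<close>

class zfc_universe =
  fixes elts :: "'a \<Rightarrow> 'a set"
  assumes extensionality: "elts x = elts y \<Longrightarrow> x = y"
    and foundation: "wf {(x, y). x \<in> elts y}"
    and pairing: "\<exists>z. elts z = {x, y}"
    and union: "\<exists>z. elts z = (\<Union>y\<in>elts x. elts y)"
    and powerset: "\<exists>z. elts z = {y. elts y \<subseteq> elts x}"
    and separation: "\<exists>z. elts z = {y \<in> elts x. P y}"
    and replacement: "\<exists>z. elts z = f ` elts x"
    and infinity: "\<exists>x. (\<exists>z\<in>elts x. elts z = {}) \<and>
                     (\<forall>y\<in>elts x. \<exists>z\<in>elts x. elts z = insert y (elts y))"

text \<open>
  Von Neumann ordinals (by foundation, transitive sets of transitive sets) and initial ordinals.
  Between ordinals, \<open>\<alpha> < \<beta>\<close> is \<open>\<alpha> \<in> elts \<beta>\<close> and \<open>\<alpha> \<le> \<beta>\<close> is \<open>elts \<alpha> \<subseteq> elts \<beta>\<close>.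
\<close>

definition ordinal :: "'v::zfc_universe \<Rightarrow> bool" where
  "ordinal \<alpha> \<longleftrightarrow>
     (\<forall>\<beta>\<in>elts \<alpha>. elts \<beta> \<subseteq> elts \<alpha>) \<and>
     (\<forall>\<beta>\<in>elts \<alpha>. \<forall>\<gamma>\<in>elts \<beta>. elts \<gamma> \<subseteq> elts \<beta>)"

definition cardinal :: "'v::zfc_universe \<Rightarrow> bool" where
  "cardinal \<kappa> \<longleftrightarrow> ordinal \<kappa> \<and> (\<forall>\<alpha>\<in>elts \<kappa>. |elts \<alpha>| <o |elts \<kappa>| )"

definition subsets_below :: "'v::zfc_universe \<Rightarrow> 'v \<Rightarrow> 'v set" ("\<P>\<^bsub>_\<^esub>'(_')") where
  "\<P>\<^bsub>\<kappa>\<^esub>(\<theta>) = {a. elts a \<subseteq> elts \<theta> \<and> |elts a| <o |elts \<kappa>| }"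

text \<open>Filters are proper; otherwise the family of all subsets would be a filter that is fine,
  complete, non-principal (with \<open>Y\<close> required to be nonempty) and measures everything.\<close>

definition filter_on :: "'a set \<Rightarrow> 'a set set \<Rightarrow> bool" where
  "filter_on X F \<longleftrightarrow>
     F \<subseteq> Pow X \<and> X \<in> F \<and> {} \<notin> F \<and>
     (\<forall>A\<in>F. \<forall>B\<in>F. A \<inter> B \<in> F) \<and>
     (\<forall>A\<in>F. \<forall>B. A \<subseteq> B \<and> B \<subseteq> X \<longrightarrow> B \<in> F)"

text \<open>The intersection with \<open>X\<close> only matters for the empty subfamily.\<close>

definition complete_filter :: "'v::zfc_universe \<Rightarrow> 'a set \<Rightarrow> 'a set set \<Rightarrow> bool" where
  "complete_filter \<kappa> X F \<longleftrightarrow>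
     filter_on X F \<and> (\<forall>S. S \<subseteq> F \<and> |S| <o |elts \<kappa>| \<longrightarrow> X \<inter> \<Inter>S \<in> F)"

definition non_principal :: "'a set \<Rightarrow> 'a set set \<Rightarrow> bool" where
  "non_principal X F \<longleftrightarrow> \<not> (\<exists>Y. Y \<noteq> {} \<and> Y \<subseteq> X \<and> F = {A. A \<subseteq> X \<and> Y \<subseteq> A})"

definition measures_family :: "'a set \<Rightarrow> 'a set set \<Rightarrow> 'a set set \<Rightarrow> bool" where
  "measures_family X F \<A> \<longleftrightarrow> (\<forall>A\<in>\<A>. A \<in> F \<or> X - A \<in> F)"

definition ultrafilter_on :: "'a set \<Rightarrow> 'a set set \<Rightarrow> bool" where
  "ultrafilter_on X U \<longleftrightarrow> filter_on X U \<and> measures_family X U (Pow X)"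

definition fine :: "'v::zfc_universe \<Rightarrow> 'v \<Rightarrow> 'v set set \<Rightarrow> bool" where
  "fine \<kappa> \<theta> F \<longleftrightarrow> (\<forall>\<alpha>\<in>elts \<theta>. {a \<in> \<P>\<^bsub>\<kappa>\<^esub>(\<theta>). \<alpha> \<in> elts a} \<in> F)"

definition nearly_strongly_compact :: "'v::zfc_universe \<Rightarrow> 'v \<Rightarrow> bool" where
  "nearly_strongly_compact \<theta> \<kappa> \<longleftrightarrow>
     elts \<kappa> \<subseteq> elts \<theta> \<and>
     (\<forall>\<A>. \<A> \<subseteq> Pow \<P>\<^bsub>\<kappa>\<^esub>(\<theta>) \<and> |\<A>| =o |elts \<theta>| \<longrightarrow>
        (\<exists>F. complete_filter \<kappa> \<P>\<^bsub>\<kappa>\<^esub>(\<theta>) F \<and> non_principal \<P>\<^bsub>\<kappa>\<^esub>(\<theta>) F \<and>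
             fine \<kappa> \<theta> F \<and> measures_family \<P>\<^bsub>\<kappa>\<^esub>(\<theta>) F \<A>))"

text \<open>Generation is meant in the sense of \<open>(<\<kappa>)\<close>-complete filters. A \<open>(<\<kappa>)\<close>-complete filter that
  is generated by \<open>G\<close> as a plain filter is also generated by \<open>G\<close> in this sense.\<close>

definition generates :: "'v::zfc_universe \<Rightarrow> 'a set \<Rightarrow> 'a set set \<Rightarrow> 'a set set \<Rightarrow> bool" where
  "generates \<kappa> X G F \<longleftrightarrow>
     complete_filter \<kappa> X F \<and> G \<subseteq> F \<and> (\<forall>F'. complete_filter \<kappa> X F' \<and> G \<subseteq> F' \<longrightarrow> F \<subseteq> F')"

definition strongly_compact :: "'v::zfc_universe \<Rightarrow> bool" where
  "strongly_compact \<kappa> \<longleftrightarrow>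
     (\<forall>\<theta>. cardinal \<theta> \<and> elts \<kappa> \<subseteq> elts \<theta> \<longrightarrow>
        (\<forall>(x::'v) G F. |G| \<le>o |elts \<theta>| \<and> generates \<kappa> (elts x) G F \<longrightarrow>
           (\<exists>U. ultrafilter_on (elts x) U \<and> complete_filter \<kappa> (elts x) U \<and> F \<subseteq> U)))"

end

theory Submission
  imports Defs
begin

text \<open>
  A \<open>(<\<kappa>)\<close>-complete filter \<open>F\<close> on \<open>X\<close> extends to an ultrafilter as soon as \<open>\<kappa>\<close> is nearly
  \<open>\<theta>\<close>-strongly compact for some \<open>\<theta> \<ge> 2\<^bsup>|X|\<^esup>\<close>. Index the subsets of \<open>X\<close> by ordinals below \<open>\<theta>\<close>;
  by completeness, each \<open>a \<in> \<P>\<^bsub>\<kappa>\<^esub>(\<theta>)\<close> admits a point \<open>f a \<in> X\<close> lying in all members of \<open>F\<close> whose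
  index is in \<open>a\<close>. Take a fine \<open>(<\<kappa>)\<close>-complete filter \<open>D\<close> that measures the at most \<open>\<theta>\<close> many
  preimages under \<open>f\<close> of subsets of \<open>X\<close>. The image of \<open>D\<close> under \<open>f\<close> is a \<open>(<\<kappa>)\<close>-complete
  ultrafilter, and it contains \<open>F\<close> because \<open>D\<close> is fine.
\<close>

section \<open>Sets, ordinals and cardinals of the universe\<close>

lemma not_elts_self: "x \<notin> elts (x :: 'v::zfc_universe)"
  using wf_irrefl[OF foundation, of x] by auto

lemma ex_elts_image_subset:
  assumes "A \<subseteq> elts (x :: 'v::zfc_universe)"
  shows "\<exists>z :: 'v. elts z = f ` A"
proof -
  obtain y :: 'v where "elts y = {u \<in> elts x. u \<in> A}"
    using separation[of x "\<lambda>u. u \<in> A"] by blast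
  moreover have "{u \<in> elts x. u \<in> A} = A"
    using assms by blast
  ultimately show ?thesis
    using replacement[of f y] by simp
qed

text \<open>Separation codes every HOL subset of \<open>elts x\<close> by a member of the powerset
  in the universe, so \<open>elts\<close> maps that powerset onto
  \<open>Pow (elts x)\<close>.\<close>

lemma card_of_Pow_elts:
  "\<exists>p :: 'v. |Pow (elts (x :: 'v::zfc_universe))| \<le>o |elts p|"
proof -
  obtain p :: 'v where p: "elts p = {y. elts y \<subseteq> elts x}"
    using powerset by blast
  have "Pow (elts x) \<subseteq> elts ` elts p"
  proof
    fix A assume "A \<in> Pow (elts x)"
    then obtain z :: 'v where "elts z = id ` A"
      using ex_elts_image_subset[of A x id] by blast
    then show "A \<in> elts ` elts p"
      using p \<open>A \<in> Pow (elts x)\<close> by (auto intro!: image_eqI[of _ _ z])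
  qed
  then have "|Pow (elts x)| \<le>o |elts p|"
    by (rule ordLeq_transitive[OF card_of_mono1 card_of_image])
  then show ?thesis ..
qed

lemma ordinal_elts:
  assumes \<alpha>: "ordinal \<alpha>" and \<beta>: "\<beta> \<in> elts \<alpha>"
  shows "ordinal \<beta>"
  unfolding ordinal_def
proof (intro conjI ballI)
  fix \<gamma> assume \<gamma>: "\<gamma> \<in> elts \<beta>"
  show "elts \<gamma> \<subseteq> elts \<beta>"
    using \<alpha> \<beta> \<gamma> unfolding ordinal_def by simp
  have "elts \<beta> \<subseteq> elts \<alpha>"
    using \<alpha> \<beta> unfolding ordinal_def by simp
  then have "\<gamma> \<in> elts \<alpha>"
    using \<gamma> by (rule subsetD)
  then show "elts \<delta> \<subseteq> elts \<gamma>" if "\<delta> \<in> elts \<gamma>" for \<delta>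
    using \<alpha> that unfolding ordinal_def by simp
qed

text \<open>The Mostowski collapse of a well-ordering of the given set.\<close>

lemma ex_ordinal_equipotent:
  "\<exists>\<alpha> :: 'v. ordinal \<alpha> \<and> |elts \<alpha>| =o |elts (x :: 'v::zfc_universe)|"
proof -
  obtain r where r: "well_order_on (elts x) r"
    using well_order_on by blast
  define s where "s = r - Id"
  have wf_s: "wf s"
    using r unfolding s_def well_order_on_def by blast
  have "trans s"
    using r trans_diff_Id[of r]
    unfolding s_def well_order_on_def linear_order_on_def partial_order_on_def preorder_on_def
    by blast
  then have trans: "(u, y) \<in> s" if "(u, z) \<in> s" "(z, y) \<in> s" for u z y
    using that by (rule transD)
  have total: "(z, y) \<in> s \<or> (y, z) \<in> s" if "z \<in> elts x" "y \<in> elts x" "z \<noteq> y" for z y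
    using r that unfolding s_def well_order_on_def linear_order_on_def total_on_def by blast
  have field: "z \<in> elts x" if "(z, y) \<in> s" for z y
    using r that well_order_on_Field[of "elts x" r] unfolding s_def by (auto simp: Field_def)
  \<comment> \<open>The recursion sends \<open>y\<close> to the set of the values of
    \<open>c\<close> at the strict predecessors of \<open>y\<close>; \<open>SOME\<close> picks the
    element of the universe that codes this HOL set.\<close>
  define c :: "'v \<Rightarrow> 'v" where
    "c = wfrec s (\<lambda>g y. SOME v. elts v = g ` {z. (z, y) \<in> s})"
  have elts_c: "elts (c y) = c ` {z. (z, y) \<in> s}" for y
  proof -
    have "c y = (SOME v. elts v = cut c s y ` {z. (z, y) \<in> s})"
      unfolding c_def by (subst wfrec[OF wf_s]) simp
    also have "cut c s y ` {z. (z, y) \<in> s} = c ` {z. (z, y) \<in> s}"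
      by (intro image_cong) (auto simp: cut_apply)
    finally have "c y = (SOME v. elts v = c ` {z. (z, y) \<in> s})" .
    moreover have "\<exists>v. elts v = c ` {z. (z, y) \<in> s}"
      using field by (intro ex_elts_image_subset[of _ x]) auto
    ultimately show ?thesis
      by (metis (mono_tags, lifting) someI_ex)
  qed
  have inj: "inj_on c (elts x)"
  proof (rule inj_onI, rule ccontr)
    fix z y assume "z \<in> elts x" "y \<in> elts x" "c z = c y" "z \<noteq> y"
    \<comment> \<open>Of two distinct points one precedes the other, so its value is a member of the
      other value; equal values would then contradict foundation.\<close>
    then have "c z \<in> elts (c y) \<or> c y \<in> elts (c z)"
      using total elts_c by blast
    then show False
      using \<open>c z = c y\<close> not_elts_self by metis
  qed
  have transitive: "elts v \<subseteq> elts (c y)" if "v \<in> elts (c y)" for v y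
    using that trans unfolding elts_c by (auto simp: elts_c)
  obtain \<alpha> :: 'v where \<alpha>: "elts \<alpha> = c ` elts x"
    using replacement by blast
  have "ordinal \<alpha>"
    unfolding ordinal_def
  proof (intro conjI ballI)
    fix \<beta> assume "\<beta> \<in> elts \<alpha>"
    then obtain y where \<beta>: "\<beta> = c y"
      using \<alpha> by blast
    show "elts \<beta> \<subseteq> elts \<alpha>"
      unfolding \<alpha> \<beta> elts_c using field by blast
    show "elts \<gamma> \<subseteq> elts \<beta>" if "\<gamma> \<in> elts \<beta>" for \<gamma>
      using that unfolding \<beta> by (rule transitive)
  qed
  moreover have "|elts \<alpha>| =o |elts x|"
    unfolding \<alpha> using inj card_of_ordIso ordIso_symmetric inj_on_imp_bij_betw by blast
  ultimately show ?thesis by blast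
qed

text \<open>By foundation, the ordinals equipotent with the set have an \<in>-minimal one. Its
  elements are ordinals included in it and, by minimality, not equipotent with it, so it is
  initial.\<close>

lemma ex_cardinal_equipotent:
  "\<exists>\<mu> :: 'v. cardinal \<mu> \<and> |elts \<mu>| =o |elts (x :: 'v::zfc_universe)|"
proof -
  let ?Q = "{\<alpha> :: 'v. ordinal \<alpha> \<and> |elts \<alpha>| =o |elts x|}"
  obtain \<alpha> where "\<alpha> \<in> ?Q"
    using ex_ordinal_equipotent by blast
  then obtain \<mu> where \<mu>: "\<mu> \<in> ?Q" and min: "\<And>\<beta>. \<beta> \<in> elts \<mu> \<Longrightarrow> \<beta> \<notin> ?Q"
    using wfE_min[OF foundation, of \<alpha> ?Q] by (metis (no_types, lifting) case_prodI mem_Collect_eq)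
  have "|elts \<beta>| <o |elts \<mu>|" if "\<beta> \<in> elts \<mu>" for \<beta>
  proof -
    have "ordinal \<beta>" and "elts \<beta> \<subseteq> elts \<mu>"
      using \<mu> that ordinal_elts unfolding ordinal_def by blast+
    moreover have "\<not> |elts \<beta>| =o |elts \<mu>|"
      using min[OF that] \<mu> \<open>ordinal \<beta>\<close> by (auto dest: ordIso_transitive)
    ultimately show ?thesis
      using card_of_mono1[of "elts \<beta>" "elts \<mu>"] ordLeq_iff_ordLess_or_ordIso by blast
  qed
  then show ?thesis
    using \<mu> unfolding cardinal_def by blast
qed

text \<open>Unboundedness is stated over cardinals, so the bound on the powerset must be a cardinal
  and not just a set.\<close>

lemma cardinal_above_Pow:
  "\<exists>\<mu> :: 'v. cardinal \<mu> \<and> |Pow (elts (x :: 'v::zfc_universe))| \<le>o |elts \<mu>|"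
proof -
  obtain p :: 'v where p: "|Pow (elts x)| \<le>o |elts p|"
    using card_of_Pow_elts by blast
  obtain \<mu> :: 'v where "cardinal \<mu>" "|elts \<mu>| =o |elts p|"
    using ex_cardinal_equipotent by blast
  then show ?thesis
    using ordLeq_ordIso_trans[OF p ordIso_symmetric] by blast
qed

section \<open>Near strong compactness and the extension of filters\<close>

text \<open>The sets \<open>{a. \<alpha> \<in> elts a}\<close>, told apart by singletons, raise the cardinality of a family
  with at most \<open>\<theta>\<close> members to exactly \<open>\<theta>\<close>, as the definition of near strong compactness demands.\<close>

lemma nearly_strongly_compact_le:
  fixes \<kappa> \<theta> :: "'v::zfc_universe"
  assumes near: "nearly_strongly_compact \<theta> \<kappa>" and inf: "infinite (elts \<kappa>)"
    and sub: "\<A> \<subseteq> Pow \<P>\<^bsub>\<kappa>\<^esub>(\<theta>)" and le: "|\<A>| \<le>o |elts \<theta>|"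
  obtains D where "complete_filter \<kappa> \<P>\<^bsub>\<kappa>\<^esub>(\<theta>) D" "fine \<kappa> \<theta> D"
    "measures_family \<P>\<^bsub>\<kappa>\<^esub>(\<theta>) D \<A>"
proof -
  define B where "B \<alpha> = {a \<in> \<P>\<^bsub>\<kappa>\<^esub>(\<theta>). \<alpha> \<in> elts a}" for \<alpha>
  have inf_\<theta>: "infinite (elts \<theta>)"
    using near inf finite_subset unfolding nearly_strongly_compact_def by blast
  have "inj_on B (elts \<theta>)"
  proof (rule inj_onI)
    fix \<alpha> \<beta> assume \<alpha>: "\<alpha> \<in> elts \<theta>" and eq: "B \<alpha> = B \<beta>"
    obtain z :: 'v where z: "elts z = {\<alpha>}"
      using pairing[of \<alpha> \<alpha>] by auto
    have "|{\<alpha>}| <o |elts \<kappa>|"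
      using inf by (intro finite_ordLess_infinite card_of_Well_order) (simp_all add: Field_card_of)
    then have "z \<in> B \<alpha>"
      using \<alpha> z unfolding B_def subsets_below_def by simp
    then show "\<alpha> = \<beta>"
      using eq z unfolding B_def by auto
  qed
  then have "|elts \<theta>| =o |B ` elts \<theta>|"
    using card_of_ordIso inj_on_imp_bij_betw by blast
  then have B: "|B ` elts \<theta>| \<le>o |elts \<theta>|" "|elts \<theta>| \<le>o |B ` elts \<theta>|"
    using ordIso_iff_ordLeq by blast+
  \<comment> \<open>Since \<theta> is infinite, the union of two families of size at most \<theta>
    still has size at most \<theta>.\<close>
  have "|\<A> \<union> B ` elts \<theta>| \<le>o |elts \<theta>|"
    using inf_\<theta> le B(1)
    by (intro card_of_Un_ordLeq_infinite_Field) (simp_all add: Field_card_of card_of_card_order_on)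
  moreover have "|elts \<theta>| \<le>o |\<A> \<union> B ` elts \<theta>|"
    by (rule ordLeq_transitive[OF B(2) card_of_mono1]) blast
  ultimately have "|\<A> \<union> B ` elts \<theta>| =o |elts \<theta>|"
    using ordIso_iff_ordLeq by blast
  moreover have "\<A> \<union> B ` elts \<theta> \<subseteq> Pow \<P>\<^bsub>\<kappa>\<^esub>(\<theta>)"
    using sub unfolding B_def by blast
  ultimately obtain D where "complete_filter \<kappa> \<P>\<^bsub>\<kappa>\<^esub>(\<theta>) D" "fine \<kappa> \<theta> D"
    "measures_family \<P>\<^bsub>\<kappa>\<^esub>(\<theta>) D (\<A> \<union> B ` elts \<theta>)"
    using near unfolding nearly_strongly_compact_def by blast
  then show ?thesis
    using that unfolding measures_family_def by blast
qed

text \<open>Taking preimages under \<open>f\<close> preserves inclusions and intersections, and the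
  preimages of the members of \<open>S\<close> form a family no larger than \<open>S\<close>. So
  properness, closure and completeness pass from \<open>D\<close> to its image.\<close>

lemma complete_filter_image:
  assumes D: "complete_filter \<kappa> P D" and f: "f ` P \<subseteq> X"
  shows "complete_filter \<kappa> X {A. A \<subseteq> X \<and> {a \<in> P. f a \<in> A} \<in> D}"
proof -
  define U where "U = {A. A \<subseteq> X \<and> {a \<in> P. f a \<in> A} \<in> D}"
  have filter: "filter_on P D"
    using D unfolding complete_filter_def by blast
  have up: "B \<in> D" if "A \<in> D" "A \<subseteq> B" "B \<subseteq> P" for A B
    using filter that unfolding filter_on_def by blast
  have "{a \<in> P. f a \<in> X} = P"
    using f by blast
  then have "X \<in> U"
    using filter unfolding U_def filter_on_def by simp
  moreover have "{} \<notin> U"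
    using filter unfolding U_def filter_on_def by simp
  moreover have "A \<inter> B \<in> U" if "A \<in> U" "B \<in> U" for A B
  proof -
    have "{a \<in> P. f a \<in> A} \<inter> {a \<in> P. f a \<in> B} \<in> D"
      using filter that unfolding U_def filter_on_def by simp
    moreover have "{a \<in> P. f a \<in> A} \<inter> {a \<in> P. f a \<in> B} = {a \<in> P. f a \<in> A \<inter> B}"
      by blast
    ultimately show ?thesis
      using that unfolding U_def by auto
  qed
  moreover have "B \<in> U" if "A \<in> U" "A \<subseteq> B" "B \<subseteq> X" for A B
    using that up[of "{a \<in> P. f a \<in> A}" "{a \<in> P. f a \<in> B}"] unfolding U_def by blast
  moreover have "U \<subseteq> Pow X"
    unfolding U_def by blast
  ultimately have "filter_on X U"
    unfolding filter_on_def by blast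
  moreover have "X \<inter> \<Inter>S \<in> U" if S: "S \<subseteq> U" "|S| <o |elts \<kappa>|" for S
  proof -
    let ?T = "(\<lambda>A. {a \<in> P. f a \<in> A}) ` S"
    have "|?T| <o |elts \<kappa>|"
      by (rule ordLeq_ordLess_trans[OF card_of_image S(2)])
    moreover have "?T \<subseteq> D"
      using S(1) unfolding U_def by auto
    ultimately have "P \<inter> \<Inter>?T \<in> D"
      using D unfolding complete_filter_def by simp
    moreover have "P \<inter> \<Inter>?T = {a \<in> P. f a \<in> X \<inter> \<Inter>S}"
      using f by auto
    ultimately show ?thesis
      unfolding U_def by simp
  qed
  ultimately show ?thesis
    unfolding complete_filter_def U_def by blast
qed

lemma complete_filter_extends_to_ultrafilter:
  fixes \<kappa> \<theta> :: "'v::zfc_universe" and X :: "'a set"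
  assumes near: "nearly_strongly_compact \<theta> \<kappa>" and inf: "infinite (elts \<kappa>)"
    and Pow_le: "|Pow X| \<le>o |elts \<theta>|" and F: "complete_filter \<kappa> X F"
  shows "\<exists>U. ultrafilter_on X U \<and> complete_filter \<kappa> X U \<and> F \<subseteq> U"
proof -
  let ?P = "\<P>\<^bsub>\<kappa>\<^esub>(\<theta>)"
  have F_Pow: "F \<subseteq> Pow X" and F_proper: "{} \<notin> F"
    using F unfolding complete_filter_def filter_on_def by blast+
  obtain h where h: "inj_on h (Pow X)" "h ` Pow X \<subseteq> elts \<theta>"
    using Pow_le card_of_ordLeq[of "Pow X" "elts \<theta>"] by blast
  \<comment> \<open>Outside \<open>?P\<close> the choice may be arbitrary, because all preimages are
    taken within \<open>?P\<close>.\<close>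
  define f where "f a = (SOME y. y \<in> X \<inter> \<Inter>{A \<in> F. h A \<in> elts a})" for a
  have f: "f a \<in> X \<inter> \<Inter>{A \<in> F. h A \<in> elts a}" if "a \<in> ?P" for a
  proof -
    \<comment> \<open>Injectivity of \<open>h\<close> bounds the number of members of
      \<open>F\<close> indexed by \<open>a\<close> by the size of \<open>a\<close>, which is below
      \<kappa>. Their intersection is thus in \<open>F\<close>, and it is nonempty because
      \<open>F\<close> is proper.\<close>
    have "inj_on h {A \<in> F. h A \<in> elts a}"
      using h(1) F_Pow by (auto intro: inj_on_subset)
    then have "|{A \<in> F. h A \<in> elts a}| \<le>o |elts a|"
      by (rule card_of_ordLeqI) auto
    then have "|{A \<in> F. h A \<in> elts a}| <o |elts \<kappa>|"
      using that ordLeq_ordLess_trans unfolding subsets_below_def by auto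
    then have "X \<inter> \<Inter>{A \<in> F. h A \<in> elts a} \<in> F"
      using F unfolding complete_filter_def by simp
    then have "X \<inter> \<Inter>{A \<in> F. h A \<in> elts a} \<noteq> {}"
      using F_proper by metis
    then have "\<exists>y. y \<in> X \<inter> \<Inter>{A \<in> F. h A \<in> elts a}"
      by (simp only: ex_in_conv not_False_eq_True)
    then show ?thesis
      unfolding f_def by (rule someI_ex)
  qed
  define \<A> where "\<A> = (\<lambda>A. {a \<in> ?P. f a \<in> A}) ` Pow X"
  have "\<A> \<subseteq> Pow ?P"
    unfolding \<A>_def by blast
  moreover have "|\<A>| \<le>o |elts \<theta>|"
    unfolding \<A>_def by (rule ordLeq_transitive[OF card_of_image Pow_le])
  ultimately obtain D where D: "complete_filter \<kappa> ?P D" and fine: "fine \<kappa> \<theta> D"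
    and measures: "measures_family ?P D \<A>"
    using nearly_strongly_compact_le[OF near inf] by blast
  define U where "U = {A. A \<subseteq> X \<and> {a \<in> ?P. f a \<in> A} \<in> D}"
  have U: "complete_filter \<kappa> X U"
    unfolding U_def using D f by (intro complete_filter_image) auto
  have "A \<in> U \<or> X - A \<in> U" if "A \<subseteq> X" for A
  proof -
    have "{a \<in> ?P. f a \<in> A} \<in> D \<or> ?P - {a \<in> ?P. f a \<in> A} \<in> D"
      using measures that unfolding measures_family_def \<A>_def by blast
    \<comment> \<open>As \<open>f\<close> maps \<open>?P\<close> into \<open>X\<close>, complements
      of preimages are preimages of complements; so measuring \<A> makes the image filter decide
      every subset of \<open>X\<close>.\<close>
    moreover have "?P - {a \<in> ?P. f a \<in> A} = {a \<in> ?P. f a \<in> X - A}"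
      using f by blast
    ultimately show ?thesis
      using that unfolding U_def by auto
  qed
  then have "ultrafilter_on X U"
    using U unfolding ultrafilter_on_def measures_family_def complete_filter_def by blast
  moreover have "F \<subseteq> U"
  proof
    fix A assume A: "A \<in> F"
    then have "h A \<in> elts \<theta>"
      using F_Pow h(2) by blast
    \<comment> \<open>Fineness is applied at the index \<open>h A\<close>: whenever \<open>a\<close>
      contains it, \<open>A\<close> is among the sets that \<open>f a\<close> was chosen to lie
      in.\<close>
    then have "{a \<in> ?P. h A \<in> elts a} \<in> D"
      using fine unfolding fine_def by blast
    moreover have "{a \<in> ?P. h A \<in> elts a} \<subseteq> {a \<in> ?P. f a \<in> A}"
      using f A by blast
    moreover have "{a \<in> ?P. f a \<in> A} \<subseteq> ?P"
      by blast
    ultimately have "{a \<in> ?P. f a \<in> A} \<in> D"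
      using D unfolding complete_filter_def filter_on_def by blast
    then show "A \<in> U"
      using A F_Pow unfolding U_def by blast
  qed
  ultimately show ?thesis
    using U by blast
qed

theorem theorem6p3:
  fixes \<kappa> :: "'v::zfc_universe"
  assumes "cardinal \<kappa>" and "uncountable (elts \<kappa>)"
    and "\<forall>\<mu>. cardinal \<mu> \<longrightarrow>
           (\<exists>\<theta>. cardinal \<theta> \<and> \<mu> \<in> elts \<theta> \<and> nearly_strongly_compact \<theta> \<kappa>)"
  shows "strongly_compact \<kappa>"
  unfolding strongly_compact_def
proof (intro allI impI)
  fix x :: 'v and \<theta>' :: 'v and G F
  assume "|G| \<le>o |elts \<theta>'| \<and> generates \<kappa> (elts x) G F"
  then have F: "complete_filter \<kappa> (elts x) F"
    unfolding generates_def by blast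
  \<comment> \<open>Unboundedness above a cardinal \<mu> of size at least that of the powerset
    yields a \<theta> large enough to index all subsets of \<open>elts x\<close>.\<close>
  obtain \<mu> :: 'v where "cardinal \<mu>" and \<mu>: "|Pow (elts x)| \<le>o |elts \<mu>|"
    using cardinal_above_Pow by blast
  then obtain \<theta> where \<theta>: "cardinal \<theta>" "\<mu> \<in> elts \<theta>" and near: "nearly_strongly_compact \<theta> \<kappa>"
    using assms(3) by blast
  \<comment> \<open>The cardinal \<theta> is a transitive set, so the membership of \<mu> in it
    gives inclusion and hence a comparison of sizes.\<close>
  have "elts \<mu> \<subseteq> elts \<theta>"
    using \<theta> unfolding cardinal_def ordinal_def by blast
  then have "|Pow (elts x)| \<le>o |elts \<theta>|"
    by (rule ordLeq_transitive[OF \<mu> card_of_mono1])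
  moreover have "infinite (elts \<kappa>)"
    using assms(2) countable_finite by blast
  ultimately show "\<exists>U. ultrafilter_on (elts x) U \<and> complete_filter \<kappa> (elts x) U \<and> F \<subseteq> U"
    using complete_filter_extends_to_ultrafilter near F by blast
qed

end
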